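(* Let $S\subset\mathbb{R}^3$ be a sphere with center $O$. To generate the shadow at $O$, it is sufficient to have three pairwise non-overlapping closed (respectively, open) solid prolate ellipsoids with centers on $S$, none of which contains $O$; that is, there exist three such ellipsoids which generate the shadow at $O$. Moreover, these three ellipsoids can be chosen to be mutually homothetic.
   Context: A closed (respectively, open) solid prolate ellipsoid is a set which, in suitable Cartesian coordinates centered at its center, is given by $\frac{x_1^2}{a^2}+\frac{x_2^2+x_3^2}{b^2}\le 1$ (respectively, $<1$) with $a>b>0$. Non-overlapping means pairwise disjoint. Two sets are homothetic if one is the image of the other under a map $x\mapsto \lambda x+c$ with $\lambda>0$ and $c\in\mathbb{R}^3$. A collection of sets generates the shadow at a point $O$ if every (two-sided infinite) straight line passing through $O$ intersects at least one of the sets of the collection. The statement is asserted both for closed and for open ellipsoids. *)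

theory Defs
  imports "HOL-Analysis.Analysis"
begin

text \<open>The coordinates of a point \<open>x\<close> in a Cartesian system with origin \<open>c\<close> are the components of
  \<open>f (x - c)\<close> for an orthogonal transformation \<open>f\<close>; both orientations are allowed.\<close>

definition closed_prolate_ellipsoid :: "real^3 \<Rightarrow> (real^3) set \<Rightarrow> bool" where
  "closed_prolate_ellipsoid c E \<longleftrightarrow>
     (\<exists>(f :: real^3 \<Rightarrow> real^3) a b. orthogonal_transformation f \<and> a > b \<and> b > 0 \<and>
        E = {x. (f (x - c) $ 1)\<^sup>2 / a\<^sup>2 + ((f (x - c) $ 2)\<^sup>2 + (f (x - c) $ 3)\<^sup>2) / b\<^sup>2 \<le> 1})"

definition open_prolate_ellipsoid :: "real^3 \<Rightarrow> (real^3) set \<Rightarrow> bool" where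
  "open_prolate_ellipsoid c E \<longleftrightarrow>
     (\<exists>(f :: real^3 \<Rightarrow> real^3) a b. orthogonal_transformation f \<and> a > b \<and> b > 0 \<and>
        E = {x. (f (x - c) $ 1)\<^sup>2 / a\<^sup>2 + ((f (x - c) $ 2)\<^sup>2 + (f (x - c) $ 3)\<^sup>2) / b\<^sup>2 < 1})"

definition homothetic :: "(real^3) set \<Rightarrow> (real^3) set \<Rightarrow> bool" where
  "homothetic A B \<longleftrightarrow> (\<exists>k c. k > 0 \<and> B = (\<lambda>x. k *\<^sub>R x + c) ` A)"

definition generates_shadow :: "(real^3) set set \<Rightarrow> real^3 \<Rightarrow> bool" where
  "generates_shadow \<C> p \<longleftrightarrow>
     (\<forall>L. affine L \<and> aff_dim L = 1 \<and> p \<in> L \<longrightarrow> (\<exists>E\<in>\<C>. L \<inter> E \<noteq> {}))"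

end

theory Submission
  imports Defs
begin

text \<open>
  Homothetic prolate ellipsoids have parallel long axes and a common ratio of half-axes. Squeezing
  space along that axis by this ratio, here 10, turns them into balls, maps lines to lines, and
  flattens the sphere of centers into a thin oblate spheroid. So it suffices to find
  three disjoint balls with centers on the spheroid that miss its center and meet every line
  through it.

  Put the centers on the three coordinate axes, at distances \<open>1/10\<close>, \<open>1\<close> and \<open>1\<close> from the origin
  (in units of the radius \<open>r\<close>). A line of direction \<open>w\<close> meets the open ball of radius \<open>\<rho>\<close> whose
  center is at distance \<open>\<delta>\<close> on the \<open>i\<close>-th axis iff \<open>w\<^sub>i\<^sup>2 > (1 - \<rho>\<^sup>2/\<delta>\<^sup>2) |w|\<^sup>2\<close>. As \<open>|w|\<^sup>2\<close> is the sum
  of the \<open>w\<^sub>i\<^sup>2\<close>, no line escapes all the balls as soon as the numbers \<open>1 - \<rho>\<^sup>2/\<delta>\<^sup>2\<close> have sum less than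
  1 (\<open>line_meets_some_axis_ball\<close>).

  Without squeezing, all \<open>\<delta>\<close> would be equal and three such balls satisfying the sum condition
  would overlap. The squeezing is what makes room: the ball near the origin is tiny, yet its radius \<open>97/1000\<close> is nearly the
  distance \<open>1/10\<close> of its center, so it blocks all lines except those close to the orthogonal
  plane. Lines in that plane are then blocked by the two large balls, which need only
  \<open>\<rho>\<^sub>2\<^sup>2 + \<rho>\<^sub>3\<^sup>2 > 1\<close>, while disjointness asks for \<open>\<rho>\<^sub>2 + \<rho>\<^sub>3 < \<surd>2\<close>. For unequal radii both are
  possible; \<open>1/2\<close> and \<open>9/10\<close> do. All inequalities are strict, which is why the same centers and
  radii serve for closed and for open ellipsoids.
\<close>

section \<open>Lines through the origin and balls centered on the axes\<close>

text \<open>If no ball is met, each squared coordinate of \<open>w\<close> is at most \<open>1 - (\<rho> i / \<delta> i)\<^sup>2\<close> times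
  \<open>|w|\<^sup>2\<close>; summing over the coordinates contradicts Pythagoras.\<close>

lemma line_meets_some_axis_ball:
  fixes w :: "real^'n" and \<delta> \<rho> :: "'n \<Rightarrow> real"
  assumes "w \<noteq> 0" and \<delta>: "\<And>i. \<delta> i > 0" and \<rho>: "\<And>i. \<rho> i > 0"
    and sum: "(\<Sum>i\<in>UNIV. 1 - (\<rho> i / \<delta> i)\<^sup>2) < 1"
  shows "\<exists>i t. norm (t *\<^sub>R w - \<delta> i *\<^sub>R axis i 1) < \<rho> i"
proof -
  define W where "W = (norm w)\<^sup>2"
  have W: "W > 0" using \<open>w \<noteq> 0\<close> by (simp add: W_def)
  have W_sum: "W = (\<Sum>i\<in>UNIV. (w $ i)\<^sup>2)"
    by (simp add: W_def norm_vec_def L2_set_def sum_nonneg)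
  have "\<exists>i. (1 - (\<rho> i / \<delta> i)\<^sup>2) * W < (w $ i)\<^sup>2"
  proof (rule ccontr)
    assume "\<not> ?thesis"
    then have "W \<le> (\<Sum>i\<in>UNIV. (1 - (\<rho> i / \<delta> i)\<^sup>2) * W)"
      unfolding W_sum by (intro sum_mono) (simp add: not_less)
    also have "\<dots> < 1 * W"
      unfolding sum_distrib_right[symmetric] using sum W by (rule mult_strict_right_mono)
    finally show False by simp
  qed
  then obtain i where i: "(1 - (\<rho> i / \<delta> i)\<^sup>2) * W < (w $ i)\<^sup>2" by blast
  \<comment> \<open>the foot of the perpendicular from the center to the line\<close>
  define t where "t = \<delta> i * w $ i / W"
  have "(norm (t *\<^sub>R w - \<delta> i *\<^sub>R axis i 1))\<^sup>2 = t\<^sup>2 * W - 2 * t * \<delta> i * w $ i + (\<delta> i)\<^sup>2"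
    unfolding W_def power2_norm_eq_inner
    by (simp add: inner_diff_left inner_diff_right inner_axis inner_axis' inner_axis_axis
        power2_eq_square algebra_simps)
  also have "\<dots> = (\<delta> i)\<^sup>2 * (1 - (w $ i)\<^sup>2 / W)"
    using W by (simp add: t_def field_simps power2_eq_square)
  also have "\<dots> < (\<delta> i)\<^sup>2 * (\<rho> i / \<delta> i)\<^sup>2"
    using i W \<delta>[of i] by (intro mult_strict_left_mono) (auto simp: field_simps)
  also have "\<dots> = (\<rho> i)\<^sup>2" using \<delta>[of i] by (simp add: field_simps)
  finally have "norm (t *\<^sub>R w - \<delta> i *\<^sub>R axis i 1) < \<rho> i"
    using \<rho>[of i] by (metis less_eq_real_def power2_less_imp_less)
  then show ?thesis by blast
qed

lemma generates_shadowI: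
  assumes "\<And>v. v \<noteq> 0 \<Longrightarrow> \<exists>E\<in>\<C>. \<exists>t. p + t *\<^sub>R v \<in> E"
  shows "generates_shadow \<C> p"
  unfolding generates_shadow_def
proof (intro allI impI)
  fix L :: "(real^3) set"
  assume L: "affine L \<and> aff_dim L = 1 \<and> p \<in> L"
  have "L \<noteq> {p}" using L by auto
  then obtain y where y: "y \<in> L" "y \<noteq> p" using L by blast
  then obtain E t where E: "E \<in> \<C>" "p + t *\<^sub>R (y - p) \<in> E"
    using assms[of "y - p"] by auto
  have "p + t *\<^sub>R (y - p) = (1 - t) *\<^sub>R p + t *\<^sub>R y" by (simp add: algebra_simps)
  then have "p + t *\<^sub>R (y - p) \<in> L" using L y by (simp add: mem_affine)
  with E show "\<exists>E\<in>\<C>. L \<inter> E \<noteq> {}" by blast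
qed

section \<open>Ellipsoids as balls in squeezed space\<close>

definition squeeze :: "real^3 \<Rightarrow> real^3" where
  "squeeze x = (\<chi> i. if i = 1 then x $ i / 10 else x $ i)"

lemma linear_squeeze: "linear squeeze"
  by (rule linearI) (auto simp: squeeze_def vec_eq_iff add_divide_distrib)

lemma squeeze_eq_0_iff: "squeeze x = 0 \<longleftrightarrow> x = 0"
  by (auto simp: squeeze_def vec_eq_iff split: if_splits)

lemma norm_squeeze_power2: "(norm (squeeze x))\<^sup>2 = (x $ 1)\<^sup>2 / 100 + (x $ 2)\<^sup>2 + (x $ 3)\<^sup>2"
  unfolding norm_vec_def L2_set_def
  by (simp add: sum_nonneg sum_3 squeeze_def power_divide)

lemma squeeze_axis:
  "squeeze (axis i 1) = (if i = 1 then 1/10 else 1) *\<^sub>R axis i 1"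
  by (auto simp: squeeze_def vec_eq_iff axis_def)

text \<open>The body that squeezing turns into a translate of \<open>k U\<close>. The shape \<open>U\<close> is either the open
  or the closed unit ball; keeping it a parameter lets one argument serve both.\<close>

definition squeezed_copy :: "(real^3) set \<Rightarrow> real^3 \<Rightarrow> real \<Rightarrow> (real^3) set" where
  "squeezed_copy U c k = {x. squeeze (x - c) /\<^sub>R k \<in> U}"

lemma ellipsoid_form:
  assumes "k > 0"
  shows "(norm (squeeze v /\<^sub>R k))\<^sup>2 = (v $ 1)\<^sup>2 / (10 * k)\<^sup>2 + ((v $ 2)\<^sup>2 + (v $ 3)\<^sup>2) / k\<^sup>2"
  using assms by (simp add: power_mult_distrib norm_squeeze_power2 field_simps)

lemma closed_prolate_ellipsoid_squeezed_copy:
  assumes "k > 0"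
  shows "closed_prolate_ellipsoid c (squeezed_copy (cball 0 1) c k)"
  unfolding closed_prolate_ellipsoid_def
proof (intro exI conjI)
  show "orthogonal_transformation (\<lambda>x::real^3. x)" "10 * k > k" "k > 0"
    using assms by (auto simp: orthogonal_transformation_id)
  show "squeezed_copy (cball 0 1) c k = {x. ((x - c) $ 1)\<^sup>2 / (10 * k)\<^sup>2
      + (((x - c) $ 2)\<^sup>2 + ((x - c) $ 3)\<^sup>2) / k\<^sup>2 \<le> 1}"
    unfolding squeezed_copy_def mem_cball_0 ellipsoid_form[OF assms, symmetric]
    by (simp only: abs_square_le_1 abs_norm_cancel)
qed

lemma open_prolate_ellipsoid_squeezed_copy:
  assumes "k > 0"
  shows "open_prolate_ellipsoid c (squeezed_copy (ball 0 1) c k)"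
  unfolding open_prolate_ellipsoid_def
proof (intro exI conjI)
  show "orthogonal_transformation (\<lambda>x::real^3. x)" "10 * k > k" "k > 0"
    using assms by (auto simp: orthogonal_transformation_id)
  show "squeezed_copy (ball 0 1) c k = {x. ((x - c) $ 1)\<^sup>2 / (10 * k)\<^sup>2
      + (((x - c) $ 2)\<^sup>2 + ((x - c) $ 3)\<^sup>2) / k\<^sup>2 < 1}"
    unfolding squeezed_copy_def mem_ball_0 ellipsoid_form[OF assms, symmetric]
    by (simp only: abs_square_less_1 abs_norm_cancel)
qed

lemma homothetic_squeezed_copies:
  assumes "k > 0" "l > 0"
  shows "homothetic (squeezed_copy U c k) (squeezed_copy U d l)"
proof -
  define q where "q = l / k"
  have q: "q > 0" using assms by (simp add: q_def)
  define h where "h = (\<lambda>x. q *\<^sub>R x + (d - q *\<^sub>R c))"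
  have h: "squeeze (h x - d) /\<^sub>R l = squeeze (x - c) /\<^sub>R k" for x
  proof -
    have "h x - d = q *\<^sub>R (x - c)" by (simp add: h_def algebra_simps)
    then show ?thesis
      using assms by (simp add: linear_scale[OF linear_squeeze] q_def divide_inverse)
  qed
  then have mem: "h x \<in> squeezed_copy U d l \<longleftrightarrow> x \<in> squeezed_copy U c k" for x
    by (simp add: squeezed_copy_def)
  have surj: "h ((y - (d - q *\<^sub>R c)) /\<^sub>R q) = y" for y
    using q by (simp add: h_def)
  have "squeezed_copy U d l = h ` squeezed_copy U c k"
  proof (intro subset_antisym subsetI)
    fix y assume "y \<in> squeezed_copy U d l"
    then show "y \<in> h ` squeezed_copy U c k"
      by (intro image_eqI[where x = "(y - (d - q *\<^sub>R c)) /\<^sub>R q"])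
        (simp_all only: mem[symmetric] surj)
  qed (use mem in blast)
  then show ?thesis unfolding homothetic_def h_def using q by blast
qed

lemma norm_squeeze_le:
  assumes "U \<subseteq> cball 0 1" "k > 0" "x \<in> squeezed_copy U c k"
  shows "norm (squeeze (x - c)) \<le> k"
proof -
  have "squeeze (x - c) /\<^sub>R k \<in> cball 0 1" using assms unfolding squeezed_copy_def by blast
  then show ?thesis using assms(2) by (simp add: field_simps)
qed

lemma mem_squeezed_copy:
  assumes "ball 0 1 \<subseteq> U" "k > 0" "norm (squeeze (x - c)) < k"
  shows "x \<in> squeezed_copy U c k"
proof -
  have "squeeze (x - c) /\<^sub>R k \<in> ball 0 1" using assms(2,3) by (simp add: field_simps)
  then show ?thesis using assms(1) unfolding squeezed_copy_def by blast
qed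

lemma disjnt_squeezed_copies:
  assumes "U \<subseteq> cball 0 1" "k > 0" "l > 0" "k + l < norm (squeeze (c - d))"
  shows "disjnt (squeezed_copy U c k) (squeezed_copy U d l)"
  unfolding disjnt_iff
proof (intro allI notI, elim conjE)
  fix x assume x: "x \<in> squeezed_copy U c k" "x \<in> squeezed_copy U d l"
  have "c - d = (x - d) - (x - c)" by simp
  then have "squeeze (c - d) = squeeze (x - d) - squeeze (x - c)"
    by (metis linear_diff[OF linear_squeeze])
  then have "norm (squeeze (c - d)) \<le> norm (squeeze (x - d)) + norm (squeeze (x - c))"
    by (simp add: norm_triangle_ineq4)
  also have "\<dots> \<le> l + k"
    using norm_squeeze_le[OF assms(1)] x assms(2,3) by (intro add_mono) auto
  finally show False using assms(4) by simp
qed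

section \<open>The configuration\<close>

definition dist_factor :: "3 \<Rightarrow> real" where
  "dist_factor i = (if i = 1 then 1/10 else 1)"

text \<open>The covering condition reads \<open>(1 - 0.97\<^sup>2) + (1 - 0.5\<^sup>2) + (1 - 0.9\<^sup>2) = 0.9991 < 1\<close>.
  Disjointness amounts to \<open>0.5 + 0.9 < \<surd>2\<close> for the large balls; the center of the small ball is at distance more
  than 1 from the centers of the large ones, whereas the radii add up to at most \<open>0.997\<close>.\<close>

definition radius_factor :: "3 \<Rightarrow> real" where
  "radius_factor i = (if i = 1 then 97/1000 else if i = 2 then 1/2 else 9/10)"

lemma dist_factor_pos: "dist_factor i > 0"
  by (simp add: dist_factor_def)

lemma radius_factor_pos: "radius_factor i > 0"
  by (simp add: radius_factor_def)

lemma radius_factor_less_dist_factor: "radius_factor i < dist_factor i"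
  using exhaust_3[of i] by (auto simp: dist_factor_def radius_factor_def)

lemma covering_condition: "(\<Sum>i\<in>UNIV. 1 - (radius_factor i / dist_factor i)\<^sup>2) < 1"
  by (simp add: sum_3 dist_factor_def radius_factor_def power2_eq_square)

lemma radius_factors_less_dist:
  assumes "i \<noteq> j"
  shows "radius_factor i + radius_factor j < norm (squeeze (axis i 1 - axis j 1))"
proof (rule power2_less_imp_less)
  show "(radius_factor i + radius_factor j)\<^sup>2 < (norm (squeeze (axis i 1 - axis j 1)))\<^sup>2"
    unfolding norm_squeeze_power2 using assms exhaust_3[of i] exhaust_3[of j]
    by (auto simp: axis_def radius_factor_def power2_eq_square)
qed simp

text \<open>The \<open>i\<close>-th body is centered at distance \<open>r\<close> from \<open>p\<close> on the \<open>i\<close>-th axis, and squeezing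
  turns it into a ball of radius \<open>r * radius_factor i\<close> at distance \<open>r * dist_factor i\<close>. It misses
  \<open>p\<close> because the radius is smaller than the distance, and a line through \<open>p\<close> can be tested for
  intersection after squeezing because \<open>squeeze\<close> is linear and injective.\<close>

lemma shadow_configuration:
  fixes p :: "real^3" and r :: real
  assumes r: "r > 0" and U: "ball 0 1 \<subseteq> U" "U \<subseteq> cball 0 1"
    and P: "\<And>c k. k > 0 \<Longrightarrow> P c (squeezed_copy U c k)"
  shows "\<exists>\<C>. card \<C> = 3
            \<and> (\<forall>E\<in>\<C>. \<exists>c\<in>sphere p r. P c E)
            \<and> pairwise disjnt \<C>
            \<and> (\<forall>E\<in>\<C>. p \<notin> E)
            \<and> generates_shadow \<C> p
            \<and> pairwise homothetic \<C>"
proof -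
  define c where "c i = p + r *\<^sub>R axis i 1" for i :: 3
  define k where "k i = r * radius_factor i" for i
  define E where "E i = squeezed_copy U (c i) (k i)" for i
  have k: "k i > 0" for i using r radius_factor_pos by (simp add: k_def)
  have disj: "disjnt (E i) (E j)" if "i \<noteq> j" for i j
    unfolding E_def
  proof (rule disjnt_squeezed_copies[OF U(2) k k])
    have "c i - c j = r *\<^sub>R (axis i 1 - axis j 1)" by (simp add: c_def algebra_simps)
    then have "norm (squeeze (c i - c j)) = r * norm (squeeze (axis i 1 - axis j 1))"
      using r by (simp add: linear_scale[OF linear_squeeze])
    then show "k i + k j < norm (squeeze (c i - c j))"
      using radius_factors_less_dist[OF that] r by (simp add: k_def distrib_left[symmetric])
  qed
  have center: "c i \<in> E i" for i
    unfolding E_def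
    by (rule mem_squeezed_copy[OF U(1) k]) (simp add: k linear_0[OF linear_squeeze])
  have "inj E"
    using disj center by (intro injI) (metis disjnt_iff)
  then have card: "card (range E) = 3" by (simp add: card_image)
  have ellipsoids: "\<forall>F\<in>range E. \<exists>c\<in>sphere p r. P c F"
  proof clarify
    fix i
    have "c i \<in> sphere p r" using r by (simp add: c_def dist_norm)
    moreover have "P (c i) (E i)" unfolding E_def using k by (rule P)
    ultimately show "\<exists>c\<in>sphere p r. P c (E i)" by (rule bexI[rotated])
  qed
  have not_mem: "p \<notin> E i" for i
  proof
    assume "p \<in> E i"
    then have "norm (squeeze (p - c i)) \<le> k i"
      unfolding E_def by (rule norm_squeeze_le[OF U(2) k])
    moreover have "p - c i = (- r) *\<^sub>R axis i 1" by (simp add: c_def)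
    then have "squeeze (p - c i) = (- r) *\<^sub>R dist_factor i *\<^sub>R axis i 1"
      by (simp only: linear_scale[OF linear_squeeze] squeeze_axis dist_factor_def)
    ultimately have "r * dist_factor i \<le> r * radius_factor i"
      using r dist_factor_pos[of i] by (simp add: k_def)
    then show False using r radius_factor_less_dist_factor[of i] by simp
  qed
  have shadow: "generates_shadow (range E) p"
  proof (rule generates_shadowI)
    fix v :: "real^3" assume "v \<noteq> 0"
    then obtain i t where
      it: "norm (t *\<^sub>R squeeze v - dist_factor i *\<^sub>R axis i 1) < radius_factor i"
      using line_meets_some_axis_ball[OF _ dist_factor_pos radius_factor_pos covering_condition]
      by (metis squeeze_eq_0_iff)
    have "p + (r * t) *\<^sub>R v - c i = r *\<^sub>R (t *\<^sub>R v - axis i 1)"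
      by (simp add: c_def algebra_simps)
    then have "squeeze (p + (r * t) *\<^sub>R v - c i)
        = r *\<^sub>R (t *\<^sub>R squeeze v - dist_factor i *\<^sub>R axis i 1)"
      by (simp only: linear_scale[OF linear_squeeze] linear_diff[OF linear_squeeze]
          squeeze_axis dist_factor_def)
    then have "norm (squeeze (p + (r * t) *\<^sub>R v - c i)) < k i"
      using it r by (simp add: k_def)
    then have "p + (r * t) *\<^sub>R v \<in> E i"
      unfolding E_def by (rule mem_squeezed_copy[OF U(1) k])
    then show "\<exists>F\<in>range E. \<exists>t. p + t *\<^sub>R v \<in> F" by blast
  qed
  have "pairwise disjnt (range E)" unfolding pairwise_def using disj by (metis imageE)
  moreover have "pairwise homothetic (range E)"
    using homothetic_squeezed_copies[OF k k] by (auto simp: pairwise_def E_def)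
  moreover have "\<forall>F\<in>range E. p \<notin> F" using not_mem by blast
  ultimately show ?thesis using card ellipsoids shadow by blast
qed

theorem theorem2:
  fixes p :: "real^3" and r :: real
  assumes "r > 0"
  shows "(\<exists>\<C>. card \<C> = 3
            \<and> (\<forall>E\<in>\<C>. \<exists>c\<in>sphere p r. closed_prolate_ellipsoid c E)
            \<and> pairwise disjnt \<C>
            \<and> (\<forall>E\<in>\<C>. p \<notin> E)
            \<and> generates_shadow \<C> p
            \<and> pairwise homothetic \<C>)
       \<and> (\<exists>\<C>. card \<C> = 3
            \<and> (\<forall>E\<in>\<C>. \<exists>c\<in>sphere p r. open_prolate_ellipsoid c E)
            \<and> pairwise disjnt \<C>
            \<and> (\<forall>E\<in>\<C>. p \<notin> E)
            \<and> generates_shadow \<C> p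
            \<and> pairwise homothetic \<C>)"
proof (rule conjI)
  show "\<exists>\<C>. card \<C> = 3 \<and> (\<forall>E\<in>\<C>. \<exists>c\<in>sphere p r. closed_prolate_ellipsoid c E)
      \<and> pairwise disjnt \<C> \<and> (\<forall>E\<in>\<C>. p \<notin> E) \<and> generates_shadow \<C> p \<and> pairwise homothetic \<C>"
    by (rule shadow_configuration[where U = "cball 0 1" and P = closed_prolate_ellipsoid])
      (simp_all add: assms closed_prolate_ellipsoid_squeezed_copy)
  show "\<exists>\<C>. card \<C> = 3 \<and> (\<forall>E\<in>\<C>. \<exists>c\<in>sphere p r. open_prolate_ellipsoid c E)
      \<and> pairwise disjnt \<C> \<and> (\<forall>E\<in>\<C>. p \<notin> E) \<and> generates_shadow \<C> p \<and> pairwise homothetic \<C>"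
    by (rule shadow_configuration[where U = "ball 0 1" and P = open_prolate_ellipsoid])
      (simp_all add: assms open_prolate_ellipsoid_squeezed_copy)
qed

end
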